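(* Under the LRU stack model with a stack-depth distribution $s$ on $\{1,\dots,V\}$ that is non-decreasing ($s(j)\le s(j+1)$ for $1\le j\le V-1$), for any buffer capacity $C$, any finite horizon $\tau\ge1$ and any initial buffer content, the MRU policy minimizes the expected number of misses among the first $\tau$ accesses, over all eviction policies.
   Context: LRU stack model: $V$ items; the LRU stack $\Lambda_t$ lists items in order of most recent access ($\Lambda_t(1)$ most recent); the next access is $a_{t+1}=\Lambda_t(d_t)$ with $d_0,d_1,\dots$ i.i.d., $\Pr[d_t=j]=s(j)$; $\Lambda_{t+1}$ is obtained by moving $\Lambda_t(d_t)$ to the top and shifting positions $1,\dots,d_t-1$ down by one; the initial stack is given. A buffer of capacity $C$ holds at most $C$ items; an access to an item not in the buffer is a miss, the item is brought in and, if the buffer was full, the eviction policy evicts a buffered item other than the accessed one. Eviction policies may depend on time, the current state and the current access. MRU (Most Recently Used) evicts, among the buffered items other than the one just accessed, the most recently accessed one. *)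

theory Defs
  imports "HOL-Probability.Probability"
begin

text \<open>
  An LRU stack is a list without repetitions of the items in \<open>U\<close>, most recently
  accessed first. Stack positions (depths) are counted from 1, list positions from 0.
\<close>

definition lru_stack :: "'a set \<Rightarrow> 'a list \<Rightarrow> bool" where
  "lru_stack U L \<longleftrightarrow> distinct L \<and> set L = U"

definition item_at :: "'a list \<Rightarrow> nat \<Rightarrow> 'a" where
  "item_at L j = L ! (j - 1)"

definition move_to_top :: "'a list \<Rightarrow> nat \<Rightarrow> 'a list" where
  "move_to_top L j = item_at L j # take (j - 1) L @ drop j L"

text \<open>A state consists of the LRU stack and the set of buffered items.\<close>

type_synonym 'a state = "'a list \<times> 'a set"

text \<open>
  The item evicted, given the time, the state just before the access, and the accessed item.
\<close>

type_synonym 'a policy = "nat \<Rightarrow> 'a state \<Rightarrow> 'a \<Rightarrow> 'a"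

text \<open>
  The policy is consulted only on a miss with a full buffer; only there is its value constrained.
\<close>

definition eviction_policy :: "'a set \<Rightarrow> nat \<Rightarrow> 'a policy \<Rightarrow> bool" where
  "eviction_policy U C \<pi> \<longleftrightarrow>
     (\<forall>t L B a. lru_stack U L \<and> B \<subseteq> U \<and> card B = C \<and> a \<in> U - B
        \<longrightarrow> \<pi> t (L, B) a \<in> insert a B - {a})"

text \<open>
  An access does not change the relative order of the other items in the stack, so the stack
  just before the access can be used to find the most recently accessed of them.
\<close>

definition mru :: "'a policy" where
  "mru t \<sigma> a = hd (filter (\<lambda>x. x \<in> snd \<sigma> \<and> x \<noteq> a) (fst \<sigma>))"

definition next_buffer :: "nat \<Rightarrow> 'a policy \<Rightarrow> nat \<Rightarrow> 'a state \<Rightarrow> 'a \<Rightarrow> 'a set" where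
  "next_buffer C \<pi> t \<sigma> a =
     (if a \<in> snd \<sigma> then snd \<sigma>
      else if card (snd \<sigma>) < C then insert a (snd \<sigma>)
      else insert a (snd \<sigma>) - {\<pi> t \<sigma> a})"

text \<open>The state after the first \<open>t\<close> accesses, for a given sequence \<open>d\<close> of depths.\<close>

primrec state_at :: "nat \<Rightarrow> 'a policy \<Rightarrow> 'a state \<Rightarrow> (nat \<Rightarrow> nat) \<Rightarrow> nat \<Rightarrow> 'a state" where
  "state_at C \<pi> \<sigma> d 0 = \<sigma>"
| "state_at C \<pi> \<sigma> d (Suc t) =
     (let \<sigma>' = state_at C \<pi> \<sigma> d t
      in (move_to_top (fst \<sigma>') (d t),
          next_buffer C \<pi> t \<sigma>' (item_at (fst \<sigma>') (d t))))"

definition miss :: "nat \<Rightarrow> 'a policy \<Rightarrow> 'a state \<Rightarrow> (nat \<Rightarrow> nat) \<Rightarrow> nat \<Rightarrow> bool" where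
  "miss C \<pi> \<sigma> d t \<longleftrightarrow>
     item_at (fst (state_at C \<pi> \<sigma> d t)) (d t) \<notin> snd (state_at C \<pi> \<sigma> d t)"

definition num_misses :: "nat \<Rightarrow> 'a policy \<Rightarrow> 'a state \<Rightarrow> nat \<Rightarrow> (nat \<Rightarrow> nat) \<Rightarrow> nat" where
  "num_misses C \<pi> \<sigma> \<tau> d = card {t. t < \<tau> \<and> miss C \<pi> \<sigma> d t}"

definition iid_depths :: "'w measure \<Rightarrow> (nat \<Rightarrow> 'w \<Rightarrow> nat) \<Rightarrow> nat pmf \<Rightarrow> bool" where
  "iid_depths M d s \<longleftrightarrow>
     prob_space M \<and>
     prob_space.indep_vars M (\<lambda>_. count_space UNIV) d UNIV \<and>
     (\<forall>t j. measure M {\<omega> \<in> space M. d t \<omega> = j} = pmf s j)"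

definition expected_misses ::
  "nat \<Rightarrow> 'a policy \<Rightarrow> 'a state \<Rightarrow> nat \<Rightarrow> 'w measure \<Rightarrow> (nat \<Rightarrow> 'w \<Rightarrow> nat) \<Rightarrow> real" where
  "expected_misses C \<pi> \<sigma> \<tau> M d =
     (LINT \<omega>|M. real (num_misses C \<pi> \<sigma> \<tau> (\<lambda>t. d t \<omega>)))"

end

theory Submission
  imports Defs
begin

text \<open>
  Only the set of stack positions of the buffered items matters; let \<open>W\<^sub>n(A)\<close> be the expected number
  of misses of MRU over \<open>n\<close> accesses from the position set \<open>A\<close>. MRU evicts the smallest position, so
  it is optimal as soon as \<open>W\<^sub>n\<close> does not increase when a buffered position \<open>p\<close> is exchanged for a
  free position \<open>q > p\<close>.

  It suffices to treat \<open>q = p + 1\<close>, by induction on \<open>n\<close>. Compare \<open>X = B \<union> {q}\<close> with \<open>Y = B \<union> {p}\<close>.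
  An access at a depth other than \<open>p\<close>, \<open>q\<close> preserves the comparison. Accessing \<open>q\<close> from \<open>X\<close> or \<open>p\<close>
  from \<open>Y\<close> is a hit leading to the same position set \<open>G\<close>; accessing \<open>p\<close> from \<open>X\<close> or \<open>q\<close> from \<open>Y\<close> is
  a miss leading to the same position set \<open>H\<close>. These two depths thus contribute
  \<open>(s(q) - s(p)) (W\<^sub>n(G) - 1 - W\<^sub>n(H))\<close> to the difference of the costs, which is at most \<open>0\<close> because
  \<open>G\<close> lacks at most one position of \<open>H\<close>, and a single missing position costs at most one extra miss.

  Consequently the number of misses so far plus \<open>W\<close> of the current position set is a submartingale
  under every policy and a martingale under MRU.
\<close>

section \<open>Stack positions and their change under one access\<close>

definition new_depth :: "nat \<Rightarrow> nat \<Rightarrow> nat" where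
  "new_depth j i = (if i = j then 1 else if i < j then i + 1 else i)"

lemma new_depth_self [simp]: "new_depth j j = 1"
  by (simp add: new_depth_def)

text \<open>For \<open>j \<ge> 1\<close> the map permutes the positive positions as the cycle 1, 2,
  ..., \<open>j\<close>; position 0 would collide with \<open>j\<close>, hence the range from
  1.\<close>

lemma inj_on_new_depth: "inj_on (new_depth j) {1..V}"
  by (auto simp: inj_on_def new_depth_def split: if_splits)

lemma new_depth_in_range: "i \<in> {1..V} \<Longrightarrow> j \<in> {1..V} \<Longrightarrow> new_depth j i \<in> {1..V}"
  by (auto simp: new_depth_def)

lemma new_depth_image_range:
  assumes "j \<in> {1..V}"
  shows "new_depth j ` {1..V} = {1..V}"
  using new_depth_in_range[OF _ assms] by (intro endo_inj_surj inj_on_new_depth) auto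

lemma new_depth_less_new_depth: "p < q \<Longrightarrow> p \<noteq> j \<Longrightarrow> q \<noteq> j \<Longrightarrow> new_depth j p < new_depth j q"
  by (auto simp: new_depth_def)

lemma card_new_depth_image: "A \<subseteq> {1..V} \<Longrightarrow> card (new_depth j ` A) = card A"
  by (meson card_image inj_on_new_depth inj_on_subset)

lemma card_new_depth_image_Diff:
  assumes "A \<subseteq> {1..V}" "B \<subseteq> {1..V}"
  shows "card (new_depth j ` A - new_depth j ` B) = card (A - B)"
proof -
  have "new_depth j ` A - new_depth j ` B = new_depth j ` (A - B)"
    using inj_on_image_set_diff[OF inj_on_new_depth[of j V], of A B] assms by auto
  then show ?thesis
    using card_new_depth_image[of "A - B" V j] assms by auto
qed

text \<open>\<open>A\<close> is in the numbering before the access; renumbering by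
  \<open>new_depth j\<close> is applied separately. The top of the stack has position 1, so
  \<open>Min A\<close> is the most recently accessed buffered item.\<close>

definition mru_update :: "nat \<Rightarrow> nat \<Rightarrow> nat set \<Rightarrow> nat set" where
  "mru_update C j A =
     (if j \<in> A then A else if card A < C then insert j A else insert j (A - {Min A}))"

section \<open>The expected cost of MRU on position sets\<close>

locale nondecreasing_depths =
  fixes V C :: nat and s :: "nat \<Rightarrow> real"
  assumes nonneg: "0 \<le> s j"
    and sum_one: "(\<Sum>j = 1..V. s j) = 1"
    and nondecreasing: "1 \<le> j \<Longrightarrow> j < V \<Longrightarrow> s j \<le> s (Suc j)"
    and capacity: "1 \<le> C"
begin

text \<open>Recursion on the first access for the MRU dynamics alone: no minimum over evictions is
  taken, so optimality remains to be shown.\<close>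

primrec mru_cost :: "nat \<Rightarrow> nat set \<Rightarrow> real" where
  "mru_cost 0 A = 0"
| "mru_cost (Suc n) A =
     (\<Sum>j = 1..V. s j * (of_bool (j \<notin> A) + mru_cost n (new_depth j ` mru_update C j A)))"

definition buffers :: "nat set set" where
  "buffers = {A. A \<subseteq> {1..V} \<and> card A \<le> C}"

lemma buffersD: "A \<in> buffers \<Longrightarrow> finite A" "A \<in> buffers \<Longrightarrow> A \<subseteq> {1..V}" "A \<in> buffers \<Longrightarrow> card A \<le> C"
  by (auto simp: buffers_def intro: finite_subset)

lemma Min_buffer: "A \<in> buffers \<Longrightarrow> \<not> card A < C \<Longrightarrow> Min A \<in> A"
  using capacity by (intro Min_in) (auto dest: buffersD)

lemma insert_Diff_buffer:
  assumes "A \<in> buffers" "\<not> card A < C" "e \<in> A" "j \<in> {1..V}"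
  shows "insert j (A - {e}) \<in> buffers"
proof -
  have "card (insert j (A - {e})) \<le> Suc (card (A - {e}))"
    by (metis card_insert_le_m1 card_insert_if buffersD(1)[OF assms(1)] finite_Diff le_SucI order_refl)
  also have "\<dots> = card A"
    using assms buffersD(1) by (metis card_Suc_Diff1)
  finally show ?thesis
    using assms by (auto simp: buffers_def)
qed

lemma mru_update_buffer: "A \<in> buffers \<Longrightarrow> j \<in> {1..V} \<Longrightarrow> mru_update C j A \<in> buffers"
  using insert_Diff_buffer[OF _ _ Min_buffer]
  by (auto simp: mru_update_def buffers_def card_insert_if finite_subset)

lemma card_mru_update:
  assumes "A \<in> buffers"
  shows "card (mru_update C j A) = (if j \<in> A then card A else min C (Suc (card A)))"
  using assms Min_buffer[OF assms] buffersD[OF assms] capacity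
  by (auto simp: mru_update_def card_insert_if card_Diff_singleton)

lemma new_depth_image_buffer: "A \<in> buffers \<Longrightarrow> j \<in> {1..V} \<Longrightarrow> new_depth j ` A \<in> buffers"
  using new_depth_image_range[of j V] card_new_depth_image[of A V j] by (auto simp: buffers_def)

section \<open>Exchange, superset and gap inequalities for the MRU cost\<close>

definition exchange :: "nat \<Rightarrow> bool" where
  "exchange n \<longleftrightarrow> (\<forall>B p q. insert p B \<in> buffers \<longrightarrow> p < q \<longrightarrow> q \<le> V \<longrightarrow> p \<notin> B \<longrightarrow> q \<notin> B \<longrightarrow>
     mru_cost n (insert q B) \<le> mru_cost n (insert p B))"

text \<open>Handles buffers of different fill: in the induction step for \<open>gap_le_one\<close> a
  buffer with room can keep a position that the other one lacks.\<close>

definition superset :: "nat \<Rightarrow> bool" where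
  "superset n \<longleftrightarrow> (\<forall>B p. insert p B \<in> buffers \<longrightarrow> mru_cost n (insert p B) \<le> mru_cost n B)"

text \<open>The bound \<open>card X \<le> card Y\<close> is part of the induction invariant: with it
  \<open>X\<close> is never full while \<open>Y\<close> still has room, so an eviction from
  \<open>X\<close> alone cannot widen the gap.\<close>

definition gap_le_one :: "nat \<Rightarrow> bool" where
  "gap_le_one n \<longleftrightarrow> (\<forall>X Y. X \<in> buffers \<longrightarrow> Y \<in> buffers \<longrightarrow> card X \<le> card Y \<longrightarrow> card (Y - X) \<le> 1 \<longrightarrow>
     mru_cost n X \<le> 1 + mru_cost n Y)"

lemma exchangeD:
  "exchange n \<Longrightarrow> insert p B \<in> buffers \<Longrightarrow> p < q \<Longrightarrow> q \<le> V \<Longrightarrow> p \<notin> B \<Longrightarrow> q \<notin> B \<Longrightarrow>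
     mru_cost n (insert q B) \<le> mru_cost n (insert p B)"
  by (auto simp: exchange_def)

lemma supersetD: "superset n \<Longrightarrow> insert p B \<in> buffers \<Longrightarrow> mru_cost n (insert p B) \<le> mru_cost n B"
  by (auto simp: superset_def)

lemma gap_le_oneD:
  "gap_le_one n \<Longrightarrow> X \<in> buffers \<Longrightarrow> Y \<in> buffers \<Longrightarrow> card X \<le> card Y \<Longrightarrow> card (Y - X) \<le> 1 \<Longrightarrow>
     mru_cost n X \<le> 1 + mru_cost n Y"
  by (auto simp: gap_le_one_def)

text \<open>Optimality of MRU for a single eviction: the two resulting sets differ by
  \<open>e\<close> against \<open>Min A\<close>, and \<open>new_depth j\<close> keeps the order of
  positions other than \<open>j\<close>, so the exchange property applies after renumbering.\<close>

lemma evict_Min_le: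
  assumes "exchange n" "A \<in> buffers" "\<not> card A < C" "e \<in> A" "j \<in> {1..V} - A"
  shows "mru_cost n (new_depth j ` insert j (A - {Min A})) \<le> mru_cost n (new_depth j ` insert j (A - {e}))"
proof (cases "e = Min A")
  case False
  let ?m = "Min A"
  have m: "?m \<in> A" "?m < e"
    using Min_buffer assms False buffersD(1)[OF assms(2)] by (auto simp: less_le)
  let ?D = "new_depth j ` insert j (A - {?m, e})"
  have range: "A \<subseteq> {1..V}" "j \<noteq> e" "j \<noteq> ?m" "j \<in> {1..V}"
    using assms m buffersD by auto
  have eq1: "new_depth j ` insert j (A - {?m}) = insert (new_depth j e) ?D"
    using assms(4) False by auto
  have eq2: "new_depth j ` insert j (A - {e}) = insert (new_depth j ?m) ?D"
    using m by auto
  have notin: "new_depth j x \<notin> ?D" if "x \<in> {?m, e}" for x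
  proof -
    have "x \<notin> insert j (A - {?m, e})" "x \<in> {1..V}" "insert j (A - {?m, e}) \<subseteq> {1..V}"
      using that range m assms(4) by auto
    then show ?thesis
      using inj_on_image_mem_iff[OF inj_on_new_depth] by blast
  qed
  have "insert (new_depth j ?m) ?D \<in> buffers"
    unfolding eq2[symmetric]
    by (intro new_depth_image_buffer insert_Diff_buffer assms range(4))
  moreover have "new_depth j ?m < new_depth j e"
    using m(2) range by (intro new_depth_less_new_depth) auto
  moreover have "new_depth j e \<le> V"
    using new_depth_in_range[of e V j] range assms(4) by auto
  ultimately show ?thesis
    unfolding eq1 eq2 using assms(1) notin exchangeD by auto
qed simp

text \<open>Both buffers face the same access. The larger one hits whenever the smaller does, and
  the inclusion persists except when only the larger one must evict.\<close>

lemma superset_Suc: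
  assumes "exchange n" "superset n"
  shows "superset (Suc n)"
  unfolding superset_def
proof (intro allI impI)
  fix B p
  assume X: "insert p B \<in> buffers"
  show "mru_cost (Suc n) (insert p B) \<le> mru_cost (Suc n) B"
  proof (cases "p \<in> B")
    case False
    have fin: "finite B" and p: "p \<in> {1..V}" and cB: "card B < C"
      using X False buffersD[OF X] by auto
    have ord: "mru_cost n (new_depth j ` insert p B') \<le> mru_cost n (new_depth j ` B')"
      if "insert p B' \<in> buffers" "j \<in> {1..V}" for j B'
      using supersetD[OF assms(2), of "new_depth j p" "new_depth j ` B'"] new_depth_image_buffer[OF that] by simp
    show ?thesis
      unfolding mru_cost.simps
    proof (intro sum_mono mult_left_mono nonneg)
      fix j assume j: "j \<in> {1..V}"
      consider "j \<in> B" | "j = p" | "j \<notin> insert p B" "card (insert p B) < C"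
        | "j \<notin> insert p B" "\<not> card (insert p B) < C"
        by blast
      then show "of_bool (j \<notin> insert p B) + mru_cost n (new_depth j ` mru_update C j (insert p B))
          \<le> of_bool (j \<notin> B) + mru_cost n (new_depth j ` mru_update C j B)"
      proof cases
        case 1
        then show ?thesis
          using ord[OF X j] by (simp add: mru_update_def)
      next
        case 2
        then show ?thesis
          using cB False by (simp add: mru_update_def)
      next
        case 3
        have "insert p (insert j B) \<in> buffers"
          using 3 X j fin by (auto simp: buffers_def card_insert_if)
        then have "mru_cost n (new_depth j ` insert p (insert j B)) \<le> mru_cost n (new_depth j ` insert j B)"
          by (rule ord[OF _ j])
        then show ?thesis
          using 3 cB by (simp add: mru_update_def insert_commute)
      next
        case 4
        \<comment> \<open>Evicting \<open>p\<close> would lead to exactly the set reached from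
          \<open>B\<close>, which has room for \<open>j\<close>; evicting the minimum is no
          worse.\<close>
        have "mru_cost n (new_depth j ` insert j (insert p B - {Min (insert p B)}))
            \<le> mru_cost n (new_depth j ` insert j (insert p B - {p}))"
          using 4 X j by (intro evict_Min_le assms) auto
        then show ?thesis
          using 4 cB False by (simp add: mru_update_def)
      qed
    qed
  qed (simp add: insert_absorb)
qed

text \<open>The inequality holds depth by depth: the additive 1 either pays for the present access
  or is passed on to the future cost.\<close>

lemma gap_le_one_Suc:
  assumes "exchange n" "superset n" "gap_le_one n"
  shows "gap_le_one (Suc n)"
  unfolding gap_le_one_def
proof (intro allI impI)
  fix X Y
  assume X: "X \<in> buffers" and Y: "Y \<in> buffers" and le: "card X \<le> card Y" and gap: "card (Y - X) \<le> 1"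
  have fin: "finite X" "finite Y" and cX: "card X \<le> C" and cY: "card Y \<le> C"
    using X Y buffersD by auto
  have ord: "mru_cost n (new_depth j ` X') \<le> 1 + mru_cost n (new_depth j ` Y')"
    if "X' \<in> buffers" "Y' \<in> buffers" "j \<in> {1..V}" "card X' \<le> card Y'" "card (Y' - X') \<le> 1" for X' Y' j
  proof -
    have "X' \<subseteq> {1..V}" "Y' \<subseteq> {1..V}"
      using that buffersD by auto
    with that show ?thesis
      by (intro gap_le_oneD assms new_depth_image_buffer) (simp_all add: card_new_depth_image card_new_depth_image_Diff)
  qed
  have step: "of_bool (j \<notin> X) + mru_cost n (new_depth j ` mru_update C j X)
      \<le> 1 + (of_bool (j \<notin> Y) + mru_cost n (new_depth j ` mru_update C j Y))" if j: "j \<in> {1..V}" for j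
  proof (cases "j \<in> Y - X")
    case True
    then have "Y - X = {j}"
      using gap fin by (metis One_nat_def card_1_singletonE card_gt_0_iff empty_iff finite_Diff
          le_antisym less_eq_Suc_le singletonD)
    then have sub: "Y - {j} \<subseteq> X" by blast
    have cYj: "card (Y - {j}) = card Y - 1" "card Y > 0"
      using True fin card_gt_0_iff by auto
    have diff: "card (X - (Y - {j})) = card X - (card Y - 1)"
      using sub cYj fin by (simp add: card_Diff_subset)
    \<comment> \<open>Here \<open>X\<close> misses and \<open>Y\<close> hits, which uses up the
      additive 1, so the future costs must compare without it. If \<open>X\<close> is full, it has
      exactly one position outside \<open>Y - {j}\<close>, and evicting that one would turn
      \<open>X\<close> into \<open>Y\<close>.\<close>
    have "mru_cost n (new_depth j ` mru_update C j X) \<le> mru_cost n (new_depth j ` Y)"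
    proof (cases "card X < C")
      case False
      then have "card (X - (Y - {j})) = 1"
        using diff cYj le cX cY by simp
      then obtain e where e: "X - (Y - {j}) = {e}"
        by (metis card_1_singletonE)
      then have "insert j (X - {e}) = Y" "e \<in> X"
        using sub True by auto
      then show ?thesis
        using evict_Min_le[OF assms(1) X False, of e j] True j False by (simp add: mru_update_def)
    next
      case nonfull: True
      show ?thesis
      proof (cases "X = Y - {j}")
        case True
        with nonfull \<open>j \<in> Y - X\<close> show ?thesis
          by (simp add: mru_update_def insert_absorb)
      next
        case False
        then have "card (X - (Y - {j})) \<noteq> 0"
          using sub fin by auto
        then have "card (X - (Y - {j})) = 1" "card X = card Y"
          using diff cYj le by auto
        then obtain e where e: "X - (Y - {j}) = {e}"
          by (metis card_1_singletonE)
        then have eq: "insert j X = insert e Y"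
          using sub \<open>j \<in> Y - X\<close> by auto
        have "insert j X \<in> buffers"
          using nonfull X j fin by (auto simp: buffers_def card_insert_if)
        then have "new_depth j ` insert e Y \<in> buffers"
          using new_depth_image_buffer[OF _ j] eq by metis
        then have "mru_cost n (new_depth j ` insert e Y) \<le> mru_cost n (new_depth j ` Y)"
          using supersetD[OF assms(2)] by simp
        then show ?thesis
          using nonfull \<open>j \<in> Y - X\<close> eq by (simp add: mru_update_def)
      qed
    qed
    then show ?thesis
      using True by (simp add: mru_update_def)
  next
    case False
    let ?X = "mru_update C j X" and ?Y = "mru_update C j Y"
    \<comment> \<open>Now \<open>X\<close> pays no more than \<open>Y\<close> for this access, so it
      is enough that the premises of the gap bound survive the update.\<close>
    have "card ?X \<le> card ?Y"
      using False le cX cY by (auto simp: card_mru_update X Y)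
    moreover have "card (?Y - ?X) \<le> 1"
    proof (cases "?Y - ?X \<subseteq> Y - X")
      case True
      then show ?thesis
        using gap fin by (meson card_mono finite_Diff le_trans)
    next
      \<comment> \<open>A new missing position arises only when both buffers are full and
        \<open>X\<close> evicts a position that \<open>Y\<close> keeps. Then \<open>Min Y\<close>
        was the one missing position; \<open>Y\<close> evicts it, and \<open>Min X\<close> takes
        over its role.\<close>
      case outside: False
      have "j \<notin> X" "j \<notin> Y" "\<not> card X < C" "\<not> card Y < C"
        using outside False le cY by (auto simp: mru_update_def split: if_splits)
      then have upd: "?X = insert j (X - {Min X})" "?Y = insert j (Y - {Min Y})"
        and mem: "Min X \<in> X" "Min Y \<in> Y"
        using Min_buffer X Y by (auto simp: mru_update_def)
      then have "Min X \<in> Y" "Min X \<noteq> Min Y"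
        using outside by auto
      then have "Min Y < Min X"
        using fin by (simp add: order_less_le)
      then have "Min Y \<notin> X"
        using fin Min_le not_le by blast
      with mem have "Min Y \<in> Y - X" by simp
      then have "Y - X = {Min Y}"
        using gap fin by (metis One_nat_def card_1_singletonE card_gt_0_iff empty_iff finite_Diff
            le_antisym less_eq_Suc_le singletonD)
      then have "?Y - ?X \<subseteq> {Min X}"
        using upd by auto
      then show ?thesis
        by (metis card.empty card_mono finite.emptyI finite.insertI is_singletonI is_singleton_altdef)
    qed
    ultimately have "mru_cost n (new_depth j ` ?X) \<le> 1 + mru_cost n (new_depth j ` ?Y)"
      using mru_update_buffer X Y j by (intro ord) auto
    then show ?thesis
      using False by auto
  qed
  have "mru_cost (Suc n) X \<le> (\<Sum>j = 1..V. s j * (1 + (of_bool (j \<notin> Y) + mru_cost n (new_depth j ` mru_update C j Y))))"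
    unfolding mru_cost.simps by (intro sum_mono mult_left_mono nonneg step)
  also have "\<dots> = 1 + mru_cost (Suc n) Y"
    by (simp only: mru_cost.simps distrib_left[of _ 1] sum.distrib mult_1_right sum_one)
  finally show "mru_cost (Suc n) X \<le> 1 + mru_cost (Suc n) Y" .
qed

text \<open>No position lies strictly between \<open>p\<close> and \<open>Suc p\<close>, so every
  element of \<open>B\<close> is below both or above both. MRU thus evicts either the differing
  position from both sets or one common position from both.\<close>

lemma Min_insert_adjacent:
  assumes "finite B" "p \<notin> B" "Suc p \<notin> B"
  shows "Min (insert p B) = p \<and> Min (insert (Suc p) B) = Suc p \<or>
    Min (insert p B) = Min (insert (Suc p) B) \<and> Min (insert p B) \<in> B"
proof (cases "B = {}")
  case False
  define m where "m = Min B"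
  have m: "m \<in> B" and Min: "Min (insert x B) = min x m" for x
    using assms False by (simp_all add: m_def)
  then have "m \<noteq> p" "m \<noteq> Suc p"
    using assms by metis+
  then show ?thesis
    unfolding Min using m by (auto simp: min_def)
qed simp

lemma adjacent_exchange_Suc:
  assumes "exchange n" "gap_le_one n"
    and Y: "insert p B \<in> buffers" and p: "p < V" "p \<notin> B" "Suc p \<notin> B"
  shows "mru_cost (Suc n) (insert (Suc p) B) \<le> mru_cost (Suc n) (insert p B)"
proof -
  let ?q = "Suc p"
  let ?X = "insert ?q B" and ?Y = "insert p B"
  define f where "f A j = of_bool (j \<notin> A) + mru_cost n (new_depth j ` mru_update C j A)" for A j
  define G where "G = new_depth ?q ` ?X"
  define H where "H = new_depth ?q ` mru_update C ?q ?Y"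
  have fin: "finite B" and range: "B \<subseteq> {1..V}" "p \<in> {1..V}" "?q \<in> {1..V}"
    using buffersD[OF Y] p by auto
  have X: "?X \<in> buffers"
    using Y p fin range by (auto simp: buffers_def)
  have cards: "card ?X = card ?Y" "card ?Y = Suc (card B)"
    using p fin by auto
  note Min_adj = Min_insert_adjacent[OF fin p(2,3)]
  \<comment> \<open>The cycles for \<open>p\<close> and \<open>Suc p\<close> differ only at these
    two positions.\<close>
  have sym: "new_depth p ` D = new_depth ?q ` D" if "p \<notin> D" "?q \<notin> D" for D
    using that by (intro image_cong) (auto simp: new_depth_def)
  have pq: "new_depth p ?q = ?q" "new_depth ?q p = ?q"
    by (auto simp: new_depth_def)
  have G: "G = new_depth p ` ?Y"
    using sym[of B] p by (simp add: G_def)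
  \<comment> \<open>After either miss the accessed position of the pair is on top and the other one,
    if still buffered, is at \<open>Suc p\<close>. Whether it is still buffered is the same in both
    cases by \<open>Min_adj\<close>.\<close>
  have H: "H = new_depth p ` mru_update C p ?X"
    using Min_adj
  proof
    assume *: "Min ?Y = p \<and> Min ?X = ?q"
    then have "?Y - {Min ?Y} = B" "?X - {Min ?X} = B"
      using p by auto
    then show ?thesis
      using sym[of B] p pq cards unfolding H_def mru_update_def by simp
  next
    assume *: "Min ?Y = Min ?X \<and> Min ?Y \<in> B"
    define m where "m = Min ?Y"
    then have m: "m = Min ?X" "m \<noteq> p" "m \<noteq> ?q"
      using * p by auto
    then have "?Y - {m} = insert p (B - {m})" "?X - {m} = insert ?q (B - {m})"
      by auto
    then show ?thesis
      using sym[of B] sym[of "B - {m}"] p pq cards m(1) m_def[symmetric]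
      unfolding H_def mru_update_def by (simp add: insert_commute)
  qed
  \<comment> \<open>Both sets are images under the same injective map
    \<open>new_depth (Suc p)\<close>, so the gap can be counted before renumbering, where only
    \<open>p\<close> can be missing from \<open>insert (Suc p) B\<close>.\<close>
  have GH: "mru_cost n G \<le> 1 + mru_cost n H"
  proof -
    have U: "mru_update C ?q ?Y \<in> buffers"
      using mru_update_buffer Y range by blast
    have "mru_update C ?q ?Y - ?X \<subseteq> {p}"
      by (auto simp: mru_update_def)
    then have "card (mru_update C ?q ?Y - ?X) \<le> 1"
      by (metis card.empty card_mono finite.emptyI finite.insertI is_singletonI is_singleton_altdef)
    moreover have "card ?X \<le> card (mru_update C ?q ?Y)"
      using card_mru_update[OF Y] buffersD(3)[OF Y] cards by simp
    moreover have "?X \<subseteq> {1..V}" "mru_update C ?q ?Y \<subseteq> {1..V}"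
      using X U buffersD by blast+
    ultimately show ?thesis
      unfolding G_def H_def
      by (intro gap_le_oneD[OF assms(2)] new_depth_image_buffer X U range)
        (simp_all only: card_new_depth_image card_new_depth_image_Diff)
  qed
  have f: "f ?X j \<le> f ?Y j" if j: "j \<in> {1..V} - {p, ?q}" for j
  proof -
    \<comment> \<open>Either MRU evicts the differing position from both sets, which makes them
      equal, or they still differ by \<open>p\<close> against \<open>Suc p\<close> over a common
      rest \<open>D\<close>.\<close>
    have "mru_update C j ?X = mru_update C j ?Y \<or>
      (\<exists>D. mru_update C j ?X = insert ?q D \<and> mru_update C j ?Y = insert p D \<and> p \<notin> D \<and> ?q \<notin> D)"
    proof (cases "j \<notin> B \<and> \<not> card ?Y < C")
      case True
      then have upd: "mru_update C j ?X = insert j (?X - {Min ?X})"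
        "mru_update C j ?Y = insert j (?Y - {Min ?Y})"
        using j cards unfolding mru_update_def by auto
      from Min_adj show ?thesis
      proof
        assume "Min ?Y = p \<and> Min ?X = ?q"
        then have "?Y - {Min ?Y} = B" "?X - {Min ?X} = B"
          using p by auto
        then show ?thesis
          using upd by simp
      next
        assume *: "Min ?Y = Min ?X \<and> Min ?Y \<in> B"
        define m where "m = Min ?Y"
        then have m: "m = Min ?X" "m \<noteq> p" "m \<noteq> ?q"
          using * p by auto
        have "mru_update C j ?X = insert j (?X - {m})" "mru_update C j ?Y = insert j (?Y - {m})"
          using upd m(1) m_def by simp_all
        then show ?thesis
          using m(2,3) j p by (intro disjI2 exI[of _ "insert j (B - {m})"]) auto
      qed
    next
      case False
      then show ?thesis
        using j p cards
        by (intro disjI2 exI[of _ "if j \<in> B then B else insert j B"]) (auto simp: mru_update_def)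
    qed
    then have "mru_cost n (new_depth j ` mru_update C j ?X) \<le> mru_cost n (new_depth j ` mru_update C j ?Y)"
    proof
      assume "\<exists>D. mru_update C j ?X = insert ?q D \<and> mru_update C j ?Y = insert p D \<and> p \<notin> D \<and> ?q \<notin> D"
      then obtain D where D: "mru_update C j ?X = insert ?q D" "mru_update C j ?Y = insert p D" "p \<notin> D" "?q \<notin> D"
        by blast
      have bX: "insert ?q D \<in> buffers" and bY: "insert p D \<in> buffers"
        using mru_update_buffer[OF X] mru_update_buffer[OF Y] j D by (metis Diff_iff)+
      then have "D \<subseteq> {1..V}"
        using buffersD by blast
      then have "new_depth j x \<notin> new_depth j ` D" if "x \<in> {p, ?q}" for x
        using that D range inj_on_image_mem_iff[OF inj_on_new_depth] by blast
      moreover have "new_depth j p < new_depth j ?q"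
        using j by (intro new_depth_less_new_depth) auto
      moreover have "new_depth j ?q \<le> V"
        using new_depth_in_range[of ?q V j] j range by auto
      ultimately show ?thesis
        using exchangeD[OF assms(1), of "new_depth j p" "new_depth j ` D" "new_depth j ?q"]
          new_depth_image_buffer[OF bY] j
        unfolding D by auto
    qed simp
    then show ?thesis
      using j by (simp add: f_def)
  qed
  have fpq: "f ?X ?q = mru_cost n G" "f ?Y p = mru_cost n G"
    "f ?X p = 1 + mru_cost n H" "f ?Y ?q = 1 + mru_cost n H"
    using p G H unfolding f_def G_def H_def by (auto simp: mru_update_def)
  \<comment> \<open>The one use of the monotonicity of \<open>s\<close>; expanded, this compares the
    contributions of the depths \<open>p\<close> and \<open>Suc p\<close>.\<close>
  have "(s ?q - s p) * (mru_cost n G - (1 + mru_cost n H)) \<le> 0"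
    using nondecreasing[of p] range GH by (intro mult_nonneg_nonpos) auto
  then have pq_le: "s p * f ?X p + s ?q * f ?X ?q \<le> s p * f ?Y p + s ?q * f ?Y ?q"
    unfolding fpq by (simp add: algebra_simps)
  have split: "(\<Sum>j = 1..V. s j * f A j) = (\<Sum>j \<in> {1..V} - {p, ?q}. s j * f A j) + (s p * f A p + s ?q * f A ?q)" for A
    using range by (subst sum.subset_diff[of "{p, ?q}"]) auto
  show ?thesis
    unfolding mru_cost.simps f_def[symmetric] split
    by (intro add_mono sum_mono mult_left_mono nonneg f pq_le)
qed

text \<open>Induction on the distance from \<open>p\<close> to \<open>q\<close>: a long exchange is
  composed of an adjacent one and a shorter one.\<close>

lemma exchange_if_adjacent:
  assumes adj: "\<And>B p. insert p B \<in> buffers \<Longrightarrow> p < V \<Longrightarrow> p \<notin> B \<Longrightarrow> Suc p \<notin> B \<Longrightarrow>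
      mru_cost n (insert (Suc p) B) \<le> mru_cost n (insert p B)"
  shows "exchange n"
proof -
  have "mru_cost n (insert q B) \<le> mru_cost n (insert p B)"
    if "insert p B \<in> buffers" "q = p + Suc k" "q \<le> V" "p \<notin> B" "q \<notin> B" for p q B k
    using that
  proof (induction k arbitrary: p B)
    case 0
    then show ?case
      using adj[of p B] by simp
  next
    case (Suc k)
    have fin: "finite B" and range: "B \<subseteq> {1..V}" "p \<in> {1..V}" and cB: "Suc (card B) \<le> C"
      using buffersD[OF Suc.prems(1)] Suc.prems(4) by auto
    show ?case
    proof (cases "Suc p \<in> B")
      case False
      have "insert (Suc p) B \<in> buffers"
        using False fin range cB Suc.prems by (auto simp: buffers_def)
      then have "mru_cost n (insert q B) \<le> mru_cost n (insert (Suc p) B)"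
        using False Suc.prems by (intro Suc.IH) auto
      also have "\<dots> \<le> mru_cost n (insert p B)"
        using False Suc.prems by (intro adj) auto
      finally show ?thesis .
    next
      case True
      \<comment> \<open>\<open>Suc p\<close> is occupied, so the moves are made in the other order:
        \<open>Suc p\<close> first moves on to \<open>q\<close>, then \<open>p\<close> moves to the
        place left free.\<close>
      then obtain D where D: "B = insert (Suc p) D" "Suc p \<notin> D"
        by (meson mk_disjoint_insert)
      have "insert p (insert q D) \<in> buffers"
        using D fin range cB Suc.prems by (auto simp: buffers_def)
      then have "mru_cost n (insert (Suc p) (insert q D)) \<le> mru_cost n (insert p (insert q D))"
        using D Suc.prems by (intro adj) auto
      also have "\<dots> = mru_cost n (insert q (insert p D))"
        by (simp add: insert_commute)
      also have "\<dots> \<le> mru_cost n (insert (Suc p) (insert p D))"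
        using D Suc.prems by (intro Suc.IH) (auto simp: insert_commute)
      finally show ?thesis
        using D by (simp add: insert_commute)
    qed
  qed
  then show ?thesis
    unfolding exchange_def by (metis less_imp_Suc_add add_Suc_right)
qed

text \<open>Each property at \<open>n + 1\<close> rests on several of them at \<open>n\<close>, so
  the induction carries all three together.\<close>

lemma exchange: "exchange n"
proof -
  have "exchange n \<and> superset n \<and> gap_le_one n"
  proof (induction n)
    case 0
    then show ?case
      by (auto simp: exchange_def superset_def gap_le_one_def)
  next
    case (Suc n)
    then show ?case
      using exchange_if_adjacent[OF adjacent_exchange_Suc] superset_Suc gap_le_one_Suc by blast
  qed
  then show ?thesis by blast
qed

end

section \<open>Stacks and buffers translated to position sets\<close>

definition positions :: "'a list \<Rightarrow> 'a set \<Rightarrow> nat set" where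
  "positions L B = {j \<in> {1..length L}. item_at L j \<in> B}"

lemma length_lru_stack: "lru_stack U L \<Longrightarrow> length L = card U"
  by (auto simp: lru_stack_def distinct_card)

lemma bij_betw_item_at: "lru_stack U L \<Longrightarrow> bij_betw (item_at L) {1..length L} U"
  unfolding bij_betw_def
proof
  assume L: "lru_stack U L"
  show "inj_on (item_at L) {1..length L}"
    using L by (auto simp: inj_on_def item_at_def lru_stack_def nth_eq_iff_index_eq)
  have "item_at L ` {1..length L} = item_at L ` Suc ` {..<length L}"
    by (simp only: image_Suc_lessThan)
  also have "\<dots> = (\<lambda>i. L ! i) ` {..<length L}"
    by (simp add: image_image item_at_def)
  finally show "item_at L ` {1..length L} = U"
    using L by (auto simp: lru_stack_def set_conv_nth)
qed

lemma item_at_move_to_top: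
  assumes "i \<in> {1..length L}" "j \<in> {1..length L}"
  shows "item_at (move_to_top L j) (new_depth j i) = item_at L i"
proof -
  \<comment> \<open>Positions count from 1 and list indices from 0; for \<open>j < i\<close> both
    \<open>i\<close> and \<open>i - 1\<close> are positive, hence the two successors in the last
    case.\<close>
  consider "i = j" | k where "i = Suc k" "i < j" | k where "i = Suc (Suc k)" "j < i"
    using assms by (metis Suc_le_D antisym_conv3 atLeastAtMost_iff One_nat_def Suc_less_eq le_imp_less_Suc not_less_eq not0_implies_Suc not_less0)
  then show ?thesis
  proof cases
    case 1
    then show ?thesis
      by (simp add: item_at_def move_to_top_def new_depth_def)
  next
    case 2
    then have "k < j - 1"
      by simp
    with 2 show ?thesis
      using assms by (simp add: item_at_def move_to_top_def new_depth_def nth_append)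
  next
    case 3
    then have "\<not> k < j - 1"
      by simp
    with 3 show ?thesis
      using assms by (simp add: item_at_def move_to_top_def new_depth_def nth_append)
  qed
qed

text \<open>Moving an entry to the top keeps the multiset of entries, and with it distinctness, item
  set and length.\<close>

lemma lru_stack_move_to_top:
  assumes "lru_stack U L" "j \<in> {1..length L}"
  shows "lru_stack U (move_to_top L j)" "length (move_to_top L j) = length L"
proof -
  have "L = take (j - 1) L @ item_at L j # drop j L"
    using assms id_take_nth_drop[of "j - 1" L] by (auto simp: item_at_def)
  then have "mset (move_to_top L j) = mset L"
    unfolding move_to_top_def by (metis mset.simps(2) mset_append union_mset_add_mset_right)
  then show "lru_stack U (move_to_top L j)" "length (move_to_top L j) = length L"
    using assms(1) mset_eq_imp_distinct_iff mset_eq_setD mset_eq_length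
    unfolding lru_stack_def by blast+
qed

lemma positions_move_to_top:
  assumes "lru_stack U L" "j \<in> {1..length L}"
  shows "positions (move_to_top L j) B = new_depth j ` positions L B"
proof -
  have "positions (move_to_top L j) B =
      {k \<in> new_depth j ` {1..length L}. item_at (move_to_top L j) k \<in> B}"
    unfolding positions_def lru_stack_move_to_top(2)[OF assms] new_depth_image_range[OF assms(2)] ..
  also have "\<dots> = new_depth j ` positions L B"
    using assms(2) by (auto simp: positions_def item_at_move_to_top)
  finally show ?thesis .
qed

lemma card_positions:
  assumes "lru_stack U L" "B \<subseteq> U"
  shows "card (positions L B) = card B"
proof -
  have "item_at L ` positions L B = B"
    using bij_betw_imp_surj_on[OF bij_betw_item_at[OF assms(1)]] assms(2)
    by (auto simp: positions_def)
  moreover have "inj_on (item_at L) (positions L B)"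
    using bij_betw_imp_inj_on[OF bij_betw_item_at[OF assms(1)]]
    by (rule inj_on_subset) (auto simp: positions_def)
  ultimately show ?thesis
    by (metis card_image)
qed

lemma item_at_eq_iff:
  "lru_stack U L \<Longrightarrow> i \<in> {1..length L} \<Longrightarrow> j \<in> {1..length L} \<Longrightarrow> item_at L i = item_at L j \<longleftrightarrow> i = j"
  using bij_betw_imp_inj_on[OF bij_betw_item_at] by (rule inj_on_eq_iff)

lemma positions_insert:
  assumes "lru_stack U L" "j \<in> {1..length L}"
  shows "positions L (insert (item_at L j) B) = insert j (positions L B)"
  using item_at_eq_iff[OF assms(1) _ assms(2)] assms(2) unfolding positions_def by blast

lemma positions_Diff:
  assumes "lru_stack U L" "e \<in> {1..length L}"
  shows "positions L (B - {item_at L e}) = positions L B - {e}"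
  using item_at_eq_iff[OF assms(1) _ assms(2)] assms(2) unfolding positions_def by blast

lemma mru_in_buffer:
  assumes "lru_stack U L" "B \<subseteq> U" "B \<noteq> {}" "a \<in> U - B"
  shows "mru t (L, B) a \<in> B"
proof -
  have "filter (\<lambda>x. x \<in> B \<and> x \<noteq> a) L \<noteq> []"
    using assms by (auto simp: lru_stack_def filter_empty_conv)
  from hd_in_set[OF this] show ?thesis
    by (simp add: mru_def)
qed

lemma hd_filter_nth:
  assumes "k < length xs" "P (xs ! k)" "\<And>i. i < k \<Longrightarrow> \<not> P (xs ! i)"
  shows "hd (filter P xs) = xs ! k"
proof -
  have "filter P (take k xs) = []"
    using assms by (auto simp: filter_empty_conv in_set_conv_nth)
  then show ?thesis
    using assms(2) by (subst id_take_nth_drop[OF assms(1)]) simp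
qed

text \<open>A buffered entry before list index \<open>Min (positions L B) - 1\<close> would give a
  buffered position below the minimum, so the filtered list starts with the entry at that
  index.\<close>

lemma mru_eq_item_at_Min:
  assumes "positions L B \<noteq> {}" "a \<notin> B"
  shows "mru t (L, B) a = item_at L (Min (positions L B))"
proof -
  let ?m = "Min (positions L B)"
  have fin: "finite (positions L B)"
    by (auto simp: positions_def)
  have m: "?m \<in> positions L B"
    using assms(1) fin by simp
  then have m': "?m - 1 < length L" "L ! (?m - 1) \<in> B"
    by (auto simp: positions_def item_at_def simp del: Min_in)
  have "L ! i \<notin> B" if "i < ?m - 1" for i
  proof
    assume "L ! i \<in> B"
    then have "Suc i \<in> positions L B"
      using that m by (auto simp: positions_def item_at_def)
    then have "?m \<le> Suc i"
      using fin by simp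
    then show False
      using that by simp
  qed
  then have "hd (filter (\<lambda>x. x \<in> B \<and> x \<noteq> a) L) = L ! (?m - 1)"
    using m' assms(2) by (intro hd_filter_nth) auto
  then show ?thesis
    by (simp add: mru_def item_at_def)
qed

lemma next_buffer_bounds:
  assumes "finite U" "eviction_policy U C \<pi>" "lru_stack U L" "B \<subseteq> U" "card B \<le> C" "a \<in> U"
  shows "next_buffer C \<pi> t (L, B) a \<subseteq> U" "card (next_buffer C \<pi> t (L, B) a) \<le> C"
proof -
  have fin: "finite B"
    using assms finite_subset by blast
  show "next_buffer C \<pi> t (L, B) a \<subseteq> U"
    using assms by (auto simp: next_buffer_def)
  have "card (insert a B - {\<pi> t (L, B) a}) \<le> C" if "a \<notin> B" "\<not> card B < C"
  proof -
    have "\<pi> t (L, B) a \<in> insert a B - {a}"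
      using assms that by (auto simp: eviction_policy_def)
    then show ?thesis
      using assms(5) that fin by (simp add: card_Diff_singleton)
  qed
  then show "card (next_buffer C \<pi> t (L, B) a) \<le> C"
    using assms fin by (auto simp: next_buffer_def card_insert_if)
qed

context nondecreasing_depths
begin

lemma mru_eviction_policy: "eviction_policy U C mru"
  unfolding eviction_policy_def
proof (intro allI impI)
  fix t L B and a :: 'a
  assume *: "lru_stack U L \<and> B \<subseteq> U \<and> card B = C \<and> a \<in> U - B"
  then have "B \<noteq> {}"
    using capacity by auto
  with * have "mru t (L, B) a \<in> B"
    by (intro mru_in_buffer[of U]) auto
  with * show "mru t (L, B) a \<in> insert a B - {a}"
    by auto
qed

text \<open>On a hit or with room left the policy is not consulted and both sides agree. On a miss
  with a full buffer the evicted item sits at some position \<open>e\<close>, and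
  \<open>evict_Min_le\<close> compares \<open>e\<close> with the minimum; for MRU the two
  coincide.\<close>

lemma next_cost:
  assumes "card U = V" "lru_stack U L" "B \<subseteq> U" "card B \<le> C" "j \<in> {1..V}"
  shows "eviction_policy U C \<pi> \<Longrightarrow>
      mru_cost n (new_depth j ` mru_update C j (positions L B)) \<le>
      mru_cost n (positions (move_to_top L j) (next_buffer C \<pi> t (L, B) (item_at L j)))"
    and "mru_cost n (new_depth j ` mru_update C j (positions L B)) =
      mru_cost n (positions (move_to_top L j) (next_buffer C mru t (L, B) (item_at L j)))"
proof -
  let ?A = "positions L B" and ?a = "item_at L j"
  have len: "length L = V"
    using assms length_lru_stack by auto
  then have j: "j \<in> {1..length L}"
    using assms by simp
  note bij = bij_betw_item_at[OF assms(2)]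
  have a: "?a \<in> U"
    using bij_betwE[OF bij] j by blast
  have jA: "j \<in> ?A \<longleftrightarrow> ?a \<in> B" and cA: "card ?A = card B"
    using j assms card_positions by (auto simp: positions_def)
  have A: "?A \<in> buffers"
    using cA assms(4) len by (auto simp: buffers_def positions_def)
  have evict: "positions L (insert ?a B - {item_at L e}) = insert j (?A - {e})" if "e \<in> ?A" "j \<notin> ?A" for e
    using that j positions_insert[OF assms(2) j] positions_Diff[OF assms(2), of e]
    by (auto simp: positions_def)
  have hit_or_room: "positions (move_to_top L j) (next_buffer C \<pi> t (L, B) ?a) = new_depth j ` mru_update C j ?A"
    if "?a \<in> B \<or> card B < C" for \<pi>
    using that jA cA positions_insert[OF assms(2) j]
    by (auto simp: positions_move_to_top[OF assms(2) j] next_buffer_def mru_update_def)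
  have full: "positions (move_to_top L j) (next_buffer C \<pi> t (L, B) ?a) = new_depth j ` insert j (?A - {e})"
    if "?a \<notin> B" "\<not> card B < C" "\<pi> t (L, B) ?a = item_at L e" "e \<in> ?A" for \<pi> e
    using that jA evict[of e] by (simp add: positions_move_to_top[OF assms(2) j] next_buffer_def)
  show "mru_cost n (new_depth j ` mru_update C j ?A) \<le>
      mru_cost n (positions (move_to_top L j) (next_buffer C \<pi> t (L, B) ?a))" if "eviction_policy U C \<pi>"
  proof (cases "?a \<in> B \<or> card B < C")
    case False
    then have "\<pi> t (L, B) ?a \<in> B"
      using that assms a unfolding eviction_policy_def by (metis DiffE DiffI insertE insertI1 le_neq_implies_less)
    moreover from this have "\<pi> t (L, B) ?a \<in> item_at L ` {1..length L}"
      using assms(3) bij_betw_imp_surj_on[OF bij] by blast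
    ultimately obtain e where e: "\<pi> t (L, B) ?a = item_at L e" "e \<in> ?A"
      by (auto simp: positions_def)
    have "mru_cost n (new_depth j ` insert j (?A - {Min ?A})) \<le> mru_cost n (new_depth j ` insert j (?A - {e}))"
      using False e jA cA assms(5) by (intro evict_Min_le exchange A) auto
    then show ?thesis
      using False e jA cA full[of \<pi> e] by (simp add: mru_update_def)
  qed (simp add: hit_or_room)
  show "mru_cost n (new_depth j ` mru_update C j ?A) =
      mru_cost n (positions (move_to_top L j) (next_buffer C mru t (L, B) ?a))"
  proof (cases "?a \<in> B \<or> card B < C")
    case False
    then have "Min ?A \<in> ?A"
      using Min_buffer[OF A] cA by simp
    moreover from this have "mru t (L, B) ?a = item_at L (Min ?A)"
      using False by (intro mru_eq_item_at_Min) auto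
    ultimately show ?thesis
      using False jA cA full[of mru "Min ?A"] by (simp add: mru_update_def)
  qed (simp add: hit_or_room)
qed

end

section \<open>Averages over depth words and the potential argument\<close>

definition prefix_mean :: "nat \<Rightarrow> (nat \<Rightarrow> real) \<Rightarrow> nat \<Rightarrow> ((nat \<Rightarrow> nat) \<Rightarrow> real) \<Rightarrow> real" where
  "prefix_mean V s k F = (\<Sum>x \<in> {..<k} \<rightarrow>\<^sub>E {1..V}. (\<Prod>i<k. s (x i)) * F x)"

text \<open>Tower property: the last depth is averaged first. Words are extensional functions, so
  the index set is finite and each word of length \<open>k + 1\<close> is \<open>x(k := j)\<close>
  for a unique pair.\<close>

lemma prefix_mean_Suc:
  "prefix_mean V s (Suc k) F = prefix_mean V s k (\<lambda>x. \<Sum>j = 1..V. s j * F (x(k := j)))"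
proof -
  have "prefix_mean V s (Suc k) F =
      (\<Sum>(j, x) \<in> {1..V} \<times> ({..<k} \<rightarrow>\<^sub>E {1..V}). (\<Prod>i<Suc k. s ((x(k := j)) i)) * F (x(k := j)))"
    unfolding prefix_mean_def lessThan_Suc PiE_insert_eq
    by (subst sum.reindex[OF inj_combinator]) (auto simp: case_prod_unfold)
  also have "\<dots> = (\<Sum>x \<in> {..<k} \<rightarrow>\<^sub>E {1..V}. \<Sum>j = 1..V. (\<Prod>i<Suc k. s ((x(k := j)) i)) * F (x(k := j)))"
    by (subst sum.swap) (simp add: sum.cartesian_product)
  also have "\<dots> = prefix_mean V s k (\<lambda>x. \<Sum>j = 1..V. s j * F (x(k := j)))"
    unfolding prefix_mean_def sum_distrib_left
    by (intro sum.cong refl) (simp add: mult.assoc)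
  finally show ?thesis .
qed

lemma state_at_cong: "(\<And>i. i < k \<Longrightarrow> x i = y i) \<Longrightarrow> state_at C \<pi> \<sigma> x k = state_at C \<pi> \<sigma> y k"
  by (induction k) (simp_all add: Let_def)

text \<open>Used to evaluate a run on \<open>x(k := j)\<close> through the run on \<open>x\<close>,
  and to see the miss count as a function of finitely many random depths.\<close>

lemma num_misses_cong:
  assumes "\<And>i. i < k \<Longrightarrow> x i = y i"
  shows "num_misses C \<pi> \<sigma> k x = num_misses C \<pi> \<sigma> k y"
proof -
  have "miss C \<pi> \<sigma> x t = miss C \<pi> \<sigma> y t" if "t < k" for t
    using state_at_cong[of t x y C \<pi> \<sigma>] assms that by (simp add: miss_def)
  then show ?thesis
    by (auto simp: num_misses_def intro!: arg_cong[of _ _ card])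
qed

lemma num_misses_Suc:
  "num_misses C \<pi> \<sigma> (Suc k) x = num_misses C \<pi> \<sigma> k x + of_bool (miss C \<pi> \<sigma> x k)"
proof -
  have "{t. t < Suc k \<and> miss C \<pi> \<sigma> x t} =
      {t. t < k \<and> miss C \<pi> \<sigma> x t} \<union> (if miss C \<pi> \<sigma> x k then {k} else {})"
    by (auto simp: less_Suc_eq)
  then show ?thesis
    by (simp add: num_misses_def)
qed

lemma state_at_invariant:
  assumes "finite U" "eviction_policy U C \<pi>" "lru_stack U L" "B \<subseteq> U" "card B \<le> C"
    and "\<forall>i<k. x i \<in> {1..card U}"
  shows "lru_stack U (fst (state_at C \<pi> (L, B) x k)) \<and> snd (state_at C \<pi> (L, B) x k) \<subseteq> U \<and>
    card (snd (state_at C \<pi> (L, B) x k)) \<le> C"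
  using assms(6)
proof (induction k)
  case (Suc k)
  obtain L' B' where st: "state_at C \<pi> (L, B) x k = (L', B')"
    by fastforce
  have IH: "lru_stack U L'" "B' \<subseteq> U" "card B' \<le> C" and xk: "x k \<in> {1..length L'}"
    using Suc st length_lru_stack[of U L'] by auto
  moreover have "item_at L' (x k) \<in> U"
    using bij_betwE[OF bij_betw_item_at[OF IH(1)]] xk by blast
  ultimately show ?case
    using st lru_stack_move_to_top(1) next_buffer_bounds[OF assms(1,2)] by (simp add: Let_def)
qed (use assms in simp)

context nondecreasing_depths
begin

text \<open>The cost of following \<open>\<pi>\<close> for \<open>k\<close> accesses and MRU for the
  remaining \<open>\<tau> - k\<close>, averaged over the depths after the first \<open>k\<close>. It
  interpolates between the MRU cost at \<open>k = 0\<close> and the misses of \<open>\<pi>\<close>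
  at \<open>k = \<tau>\<close>.\<close>

definition potential :: "'a policy \<Rightarrow> 'a state \<Rightarrow> nat \<Rightarrow> nat \<Rightarrow> (nat \<Rightarrow> nat) \<Rightarrow> real" where
  "potential \<pi> \<sigma> \<tau> k x = real (num_misses C \<pi> \<sigma> k x) +
     mru_cost (\<tau> - k) (positions (fst (state_at C \<pi> \<sigma> x k)) (snd (state_at C \<pi> \<sigma> x k)))"

text \<open>The past misses and the charge for the present access are common to both sides; what
  remains is \<open>next_cost\<close> averaged over the depth.\<close>

lemma potential_step:
  assumes U: "finite U" "card U = V" and "lru_stack U L" "B \<subseteq> U" "card B \<le> C" "k < \<tau>"
    and \<pi>: "eviction_policy U C \<pi>" and x: "x \<in> {..<k} \<rightarrow>\<^sub>E {1..V}"
  shows "potential \<pi> (L, B) \<tau> k x \<le> (\<Sum>j = 1..V. s j * potential \<pi> (L, B) \<tau> (Suc k) (x(k := j)))"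
    and "\<pi> = mru \<Longrightarrow>
      potential \<pi> (L, B) \<tau> k x = (\<Sum>j = 1..V. s j * potential \<pi> (L, B) \<tau> (Suc k) (x(k := j)))"
proof -
  obtain L' B' where st: "state_at C \<pi> (L, B) x k = (L', B')"
    by fastforce
  have "\<forall>i<k. x i \<in> {1..card U}"
    using x U by (auto simp: PiE_iff)
  from state_at_invariant[OF U(1) \<pi> assms(3-5) this]
  have inv: "lru_stack U L'" "B' \<subseteq> U" "card B' \<le> C"
    using st by auto
  have len: "length L' = V"
    using length_lru_stack[OF inv(1)] U by simp
  define r where "r j = mru_cost (\<tau> - Suc k)
      (positions (move_to_top L' j) (next_buffer C \<pi> k (L', B') (item_at L' j)))" for j
  define N where "N = real (num_misses C \<pi> (L, B) k x)"
  have st': "state_at C \<pi> (L, B) (x(k := j)) k = (L', B')" for j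
    using state_at_cong[of k "x(k := j)" x C \<pi> "(L, B)"] st by simp
  have "potential \<pi> (L, B) \<tau> (Suc k) (x(k := j)) = N + (of_bool (j \<notin> positions L' B') + r j)"
    if "j \<in> {1..V}" for j
    using that len num_misses_cong[of k "x(k := j)" x C \<pi> "(L, B)"]
    by (simp add: potential_def num_misses_Suc miss_def st' Let_def N_def r_def positions_def)
  then have "(\<Sum>j = 1..V. s j * potential \<pi> (L, B) \<tau> (Suc k) (x(k := j))) =
      (\<Sum>j = 1..V. s j * (N + (of_bool (j \<notin> positions L' B') + r j)))"
    by (intro sum.cong) auto
  also have "\<dots> = N + (\<Sum>j = 1..V. s j * (of_bool (j \<notin> positions L' B') + r j))"
    by (simp only: distrib_left[of _ N] sum.distrib sum_distrib_right[symmetric] sum_one mult_1_left)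
  finally have rhs: "(\<Sum>j = 1..V. s j * potential \<pi> (L, B) \<tau> (Suc k) (x(k := j))) =
      N + (\<Sum>j = 1..V. s j * (of_bool (j \<notin> positions L' B') + r j))" .
  have "\<tau> - k = Suc (\<tau> - Suc k)"
    using \<open>k < \<tau>\<close> by simp
  then have lhs: "potential \<pi> (L, B) \<tau> k x = N + (\<Sum>j = 1..V. s j * (of_bool (j \<notin> positions L' B') +
      mru_cost (\<tau> - Suc k) (new_depth j ` mru_update C j (positions L' B'))))"
    by (simp only: potential_def st N_def mru_cost.simps fst_conv snd_conv)
  note next_le = next_cost(1)[OF U(2) inv _ \<pi>] and next_eq = next_cost(2)[OF U(2) inv]
  show "potential \<pi> (L, B) \<tau> k x \<le> (\<Sum>j = 1..V. s j * potential \<pi> (L, B) \<tau> (Suc k) (x(k := j)))"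
    unfolding lhs rhs r_def
    by (intro add_left_mono sum_mono mult_left_mono nonneg next_le)
  show "potential \<pi> (L, B) \<tau> k x = (\<Sum>j = 1..V. s j * potential \<pi> (L, B) \<tau> (Suc k) (x(k := j)))" if "\<pi> = mru"
  proof -
    have "r j = mru_cost (\<tau> - Suc k) (new_depth j ` mru_update C j (positions L' B'))" if "j \<in> {1..V}" for j
      using next_eq[OF that] \<open>\<pi> = mru\<close> by (simp add: r_def)
    then have "(\<Sum>j = 1..V. s j * (of_bool (j \<notin> positions L' B') +
          mru_cost (\<tau> - Suc k) (new_depth j ` mru_update C j (positions L' B')))) =
        (\<Sum>j = 1..V. s j * (of_bool (j \<notin> positions L' B') + r j))"
      by (intro sum.cong) simp_all
    then show ?thesis
      by (simp only: lhs rhs)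
  qed
qed

text \<open>The mean potential starts at the MRU cost and ends at the mean miss count; by
  \<open>potential_step\<close> it never decreases along the way, and it stays constant for
  MRU.\<close>

lemma mru_cost_le_prefix_mean:
  assumes "finite U" "card U = V" "lru_stack U L" "B \<subseteq> U" "card B \<le> C" "eviction_policy U C \<pi>"
  shows "mru_cost \<tau> (positions L B) \<le> prefix_mean V s \<tau> (\<lambda>x. real (num_misses C \<pi> (L, B) \<tau> x))"
    and "\<pi> = mru \<Longrightarrow>
      mru_cost \<tau> (positions L B) = prefix_mean V s \<tau> (\<lambda>x. real (num_misses C \<pi> (L, B) \<tau> x))"
proof -
  define \<Phi> where "\<Phi> k = prefix_mean V s k (potential \<pi> (L, B) \<tau> k)" for k
  have start: "\<Phi> 0 = mru_cost \<tau> (positions L B)"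
    by (simp add: \<Phi>_def prefix_mean_def potential_def num_misses_def)
  have finish: "\<Phi> \<tau> = prefix_mean V s \<tau> (\<lambda>x. real (num_misses C \<pi> (L, B) \<tau> x))"
    by (simp add: \<Phi>_def prefix_mean_def potential_def)
  \<comment> \<open>\<open>prefix_mean_Suc\<close> first splits off the last depth on the right, so
    that both sums then range over the same words of length \<open>k\<close>.\<close>
  have step: "\<Phi> k \<le> \<Phi> (Suc k)" if "k < \<tau>" for k
    unfolding \<Phi>_def prefix_mean_Suc unfolding prefix_mean_def
    using assms that by (intro sum_mono mult_left_mono potential_step(1) prod_nonneg) (auto intro: nonneg)
  have "\<Phi> 0 \<le> \<Phi> k" if "k \<le> \<tau>" for k
    using that
  proof (induction k)
    case (Suc k)
    then show ?case
      using step[of k] by simp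
  qed simp
  from this[of \<tau>] start finish
  show "mru_cost \<tau> (positions L B) \<le> prefix_mean V s \<tau> (\<lambda>x. real (num_misses C \<pi> (L, B) \<tau> x))"
    by simp
  assume mru: "\<pi> = mru"
  have step: "\<Phi> k = \<Phi> (Suc k)" if "k < \<tau>" for k
    unfolding \<Phi>_def prefix_mean_Suc unfolding prefix_mean_def
    using assms that mru by (intro sum.cong refl arg_cong2[of _ _ _ _ "(*)"] potential_step(2)) auto
  have "\<Phi> 0 = \<Phi> k" if "k \<le> \<tau>" for k
    using that
  proof (induction k)
    case (Suc k)
    then show ?case
      using step[of k] by simp
  qed simp
  from this[of \<tau>] start finish
  show "mru_cost \<tau> (positions L B) = prefix_mean V s \<tau> (\<lambda>x. real (num_misses C \<pi> (L, B) \<tau> x))"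
    by simp
qed

end

section \<open>Expectations under i.i.d. depths as finite sums\<close>

lemma borel_measurable_prefix:
  fixes F :: "(nat \<Rightarrow> nat) \<Rightarrow> real"
  assumes d: "\<And>t. d t \<in> measurable M (count_space UNIV)"
    and F: "\<And>x y. (\<And>i. i < n \<Longrightarrow> x i = y i) \<Longrightarrow> F x = F y"
  shows "(\<lambda>\<omega>. F (\<lambda>t. d t \<omega>)) \<in> borel_measurable M"
  using F
proof (induction n arbitrary: F)
  case 0
  \<comment> \<open>Without coordinates \<open>F\<close> is constant, so any argument may represent
    its value.\<close>
  have "(\<lambda>\<omega>. F (\<lambda>t. d t \<omega>)) = (\<lambda>_. F undefined)"
    by (intro ext 0) simp
  then show ?case
    by (simp only: borel_measurable_const)
next
  case (Suc n)
  \<comment> \<open>Freezing coordinate \<open>n\<close> at a constant \<open>j\<close> leaves a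
    function of \<open>n\<close> coordinates; as \<open>d n\<close> has countably many values, the
    family over \<open>j\<close> can be recombined measurably.\<close>
  have "(\<lambda>\<omega>. F ((\<lambda>t. d t \<omega>)(n := j))) \<in> borel_measurable M" for j
  proof (rule Suc.IH[of "\<lambda>x. F (x(n := j))"])
    fix x y :: "nat \<Rightarrow> nat"
    assume "\<And>i. i < n \<Longrightarrow> x i = y i"
    then show "F (x(n := j)) = F (y(n := j))"
      by (intro Suc.prems) simp
  qed
  then have "(\<lambda>\<omega>. F ((\<lambda>t. d t \<omega>)(n := d n \<omega>))) \<in> borel_measurable M"
    by (rule measurable_compose_countable[OF _ d])
  moreover have "(\<lambda>t. d t \<omega>)(n := d n \<omega>) = (\<lambda>t. d t \<omega>)" for \<omega>
    by auto
  ultimately show ?case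
    by (simp only:)
qed

text \<open>Almost surely the first \<open>n\<close> depths form one of finitely many words over
  \<open>{1..V}\<close>, so the integrand is a finite combination of indicators, and the
  probabilities of the words factor by independence.\<close>

lemma expectation_prefix:
  fixes F :: "(nat \<Rightarrow> nat) \<Rightarrow> real"
  assumes iid: "iid_depths M d s" and s: "set_pmf s \<subseteq> {1..V}"
    and F: "\<And>x y. (\<And>i. i < n \<Longrightarrow> x i = y i) \<Longrightarrow> F x = F y"
  shows "(LINT \<omega>|M. F (\<lambda>t. d t \<omega>)) = prefix_mean V (pmf s) n F"
proof -
  interpret prob_space M
    using iid by (simp add: iid_depths_def)
  have indep: "indep_vars (\<lambda>_. count_space UNIV) d UNIV"
    and law: "\<And>t j. prob {\<omega> \<in> space M. d t \<omega> = j} = pmf s j"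
    using iid by (auto simp: iid_depths_def)
  have d [measurable]: "d t \<in> measurable M (count_space UNIV)" for t
    using indep by (auto simp: indep_vars_def)
  have "AE \<omega> in M. d t \<omega> \<in> {1..V}" for t
  proof -
    have "prob {\<omega> \<in> space M. d t \<omega> \<in> {1..V}} = prob (\<Union>j \<in> {1..V}. {\<omega> \<in> space M. d t \<omega> = j})"
      by (intro arg_cong[of _ _ prob]) auto
    also have "\<dots> = (\<Sum>j \<in> {1..V}. prob {\<omega> \<in> space M. d t \<omega> = j})"
      by (intro finite_measure_finite_Union) (auto simp: disjoint_family_on_def)
    also have "\<dots> = 1"
      using s by (simp only: law sum_pmf_eq_1[OF finite_atLeastAtMost])
    finally show ?thesis
      by (subst (asm) prob_Collect_eq_1) auto
  qed
  then have range: "AE \<omega> in M. \<forall>t. d t \<omega> \<in> {1..V}"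
    by (simp add: AE_all_countable)
  let ?E = "\<lambda>x. {\<omega> \<in> space M. \<forall>i<n. d i \<omega> = x i}"
  have E [measurable]: "?E x \<in> events" for x
    by measurable
  have prob_E: "prob (?E x) = (\<Prod>i<n. pmf s (x i))" for x
  \<comment> \<open>The case \<open>n = 0\<close> is separate because an intersection over no
    indices is \<open>UNIV\<close> rather than \<open>space M\<close>.\<close>
  proof (cases "n = 0")
    case True
    then show ?thesis
      by (simp add: prob_space)
  next
    case False
    have "prob (?E x) = prob (\<Inter>i \<in> {..<n}. d i -` {x i} \<inter> space M)"
      using False by (intro arg_cong[of _ _ prob]) auto
    also have "\<dots> = (\<Prod>i<n. prob (d i -` {x i} \<inter> space M))"
      using False by (intro indep_varsD[OF indep]) auto
    also have "\<dots> = (\<Prod>i<n. prob {\<omega> \<in> space M. d i \<omega> = x i})"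
      by (intro prod.cong arg_cong[of _ _ prob]) auto
    finally show ?thesis
      by (simp add: law)
  qed
  have "(LINT \<omega>|M. F (\<lambda>t. d t \<omega>)) = (LINT \<omega>|M. (\<Sum>x \<in> {..<n} \<rightarrow>\<^sub>E {1..V}. indicator (?E x) \<omega> * F x))"
  proof (rule integral_cong_AE)
    show "(\<lambda>\<omega>. F (\<lambda>t. d t \<omega>)) \<in> borel_measurable M"
      by (rule borel_measurable_prefix[OF d F])
    show "AE \<omega> in M. F (\<lambda>t. d t \<omega>) = (\<Sum>x \<in> {..<n} \<rightarrow>\<^sub>E {1..V}. indicator (?E x) \<omega> * F x)"
      using range AE_space
    proof eventually_elim
      fix \<omega> assume \<omega>: "\<forall>t. d t \<omega> \<in> {1..V}" "\<omega> \<in> space M"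
      \<comment> \<open>The observed word; the restriction makes it extensional, so it is the one
        index whose indicator does not vanish at \<open>\<omega>\<close>.\<close>
      let ?x = "restrict (\<lambda>t. d t \<omega>) {..<n}"
      have "\<omega> \<notin> ?E x" if "x \<in> ({..<n} \<rightarrow>\<^sub>E {1..V}) - {?x}" for x
      proof
        assume "\<omega> \<in> ?E x"
        then have "x i = ?x i" for i
          using that by (cases "i < n") (auto simp: PiE_def extensional_def)
        with that show False
          by auto
      qed
      then have "(\<Sum>x \<in> {..<n} \<rightarrow>\<^sub>E {1..V}. indicator (?E x) \<omega> * F x) = (\<Sum>x \<in> {?x}. indicator (?E x) \<omega> * F x)"
        using \<omega>(1) by (intro sum.mono_neutral_right finite_PiE) (simp_all add: restrict_PiE_iff)
      also have "\<dots> = F (\<lambda>t. d t \<omega>)"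
        using \<omega>(2) F[of ?x "\<lambda>t. d t \<omega>"] by simp
      finally show "F (\<lambda>t. d t \<omega>) = (\<Sum>x \<in> {..<n} \<rightarrow>\<^sub>E {1..V}. indicator (?E x) \<omega> * F x)" ..
    qed
  qed simp
  also have "\<dots> = (\<Sum>x \<in> {..<n} \<rightarrow>\<^sub>E {1..V}. (LINT \<omega>|M. indicator (?E x) \<omega> * F x))"
    by (rule Bochner_Integration.integral_sum) (simp add: emeasure_eq_measure)
  also have "\<dots> = prefix_mean V (pmf s) n F"
    unfolding prefix_mean_def using sets.sets_into_space[OF E]
    by (intro sum.cong) (simp_all add: prob_E Int_absorb2)
  finally show ?thesis .
qed

theorem theorem7:
  fixes U :: "'a set" and V C \<tau> :: nat and s :: "nat pmf"
    and M :: "'w measure" and d :: "nat \<Rightarrow> 'w \<Rightarrow> nat"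
    and L\<^sub>0 :: "'a list" and B\<^sub>0 :: "'a set"
  assumes "finite U" and "card U = V"
    and "set_pmf s \<subseteq> {1..V}"
    and "\<And>j. 1 \<le> j \<Longrightarrow> j \<le> V - 1 \<Longrightarrow> pmf s j \<le> pmf s (j + 1)"
    and "iid_depths M d s"
    and "lru_stack U L\<^sub>0"
    and "C \<ge> 1" and "B\<^sub>0 \<subseteq> U" and "card B\<^sub>0 \<le> C"
    and "\<tau> \<ge> 1"
  shows "eviction_policy U C mru \<and>
         (\<forall>\<pi>. eviction_policy U C \<pi> \<longrightarrow>
            expected_misses C mru (L\<^sub>0, B\<^sub>0) \<tau> M d \<le> expected_misses C \<pi> (L\<^sub>0, B\<^sub>0) \<tau> M d)"
proof -
  interpret nondecreasing_depths V C "pmf s"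
    using assms by unfold_locales (auto simp: sum_pmf_eq_1)
  have mean: "expected_misses C \<pi> (L\<^sub>0, B\<^sub>0) \<tau> M d =
      prefix_mean V (pmf s) \<tau> (\<lambda>x. real (num_misses C \<pi> (L\<^sub>0, B\<^sub>0) \<tau> x))" for \<pi>
    unfolding expected_misses_def
    by (intro expectation_prefix[OF assms(5,3)] arg_cong[of _ _ real] num_misses_cong)
  \<comment> \<open>The mean of every policy is at least the MRU cost of the initial positions, and
    MRU attains it.\<close>
  show ?thesis
    using mru_eviction_policy[of U] mru_cost_le_prefix_mean[OF assms(1,2,6,8,9), of _ \<tau>]
    unfolding mean by metis
qed

end
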